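(* Let $G$ be a connected graph on $n$ vertices with Laplacian matrix $L$ and perturbation Laplacian matrix $\widehat{L}$, and let $G^{w}$ be the corresponding dual number weighted graph with Laplacian $L_w=L+\widehat{L}\varepsilon$. Let $\lambda_{1}\geq\lambda_{2}\geq\cdots\geq\lambda_{n-1}\geq\lambda_{n}$ be the eigenvalues of $L$ and $\mu_{1},\dots,\mu_{n}$ the eigenvalues of $\widehat{L}$. Then (a) $|\Delta Kf(G^{w})|\leq \frac{n}{\lambda_{n-1}^{2}}\sum_{i=1}^{n}|\mu_{i}|$; (b) $|\Delta Kf(G^{w})|\leq n\,\rho(\widehat{L})\sum_{i=1}^{n-1}\frac{1}{\lambda_{i}^{2}}$.
   Context: Dual numbers: $\mathbb{D}=\{a_s+a_d\varepsilon: a_s,a_d\in\mathbb{R}\}$ with $\varepsilon\neq 0$, $\varepsilon^2=0$; $a_s$ is the standard part and $a_d$ the infinitesimal part. Dual number weighted graph: given $G=(V,E)$, $V=[n]$, and reals $\widehat{a}_e$ ($e\in E$), edge $e$ gets conductance $w(e)=1+\widehat{a}_e\varepsilon$. $L=D-A$; the perturbation Laplacian is $\widehat{L}=\widehat{D}-\widehat{A}$ where $\widehat{A}_{ij}=\widehat{a}_e$ if $e=\{i,j\}\in E$ and $0$ otherwise, and $\widehat{D}$ is diagonal with $\widehat{D}_{ii}=\sum_j\widehat{A}_{ij}$. Resistance distances: $R_{ij}(G)$ is the effective resistance with unit resistors on all edges of $G$; $R_{ij}(G^w)$ is the effective resistance in $G^w$: $R_{ii}(G^w)=0$, and for $i\ne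 j$, with net current $Y>0$ entering at $i$ and leaving at $j$, node potentials $v\in\mathbb{D}^n$ satisfy $L_wv=Y(\mathbf{1}_i-\mathbf{1}_j)$ and $R_{ij}(G^w)=(v_i-v_j)/Y$. $Kf(G)=\sum_{i<j}R_{ij}(G)$, $Kf(G^w)=\sum_{i<j}R_{ij}(G^w)$. The Kirchhoff index perturbation $\Delta Kf(G^w)$ is the infinitesimal part of $Kf(G^w)-Kf(G)$. $\rho(\cdot)$ denotes spectral radius. *)

theory Defs
  imports "Jordan_Normal_Form.Spectral_Radius"
begin

section \<open>Dual numbers\<close>

datatype dual = Dual (std_part: real) (inf_part: real)

lemma dual_eq_iff: "x = y \<longleftrightarrow> std_part x = std_part y \<and> inf_part x = inf_part y"
  by (cases x; cases y) auto

instantiation dual :: comm_ring_1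
begin

definition "0 = Dual 0 0"
definition "1 = Dual 1 0"
definition "x + y = Dual (std_part x + std_part y) (inf_part x + inf_part y)"
definition "x - y = Dual (std_part x - std_part y) (inf_part x - inf_part y)"
definition "- x = Dual (- std_part x) (- inf_part x)"
definition "x * y = Dual (std_part x * std_part y)
   (std_part x * inf_part y + inf_part x * std_part y)"

instance
  by standard
    (auto simp: zero_dual_def one_dual_def plus_dual_def minus_dual_def uminus_dual_def
      times_dual_def algebra_simps)

end

instantiation dual :: real_algebra_1
begin

definition "scaleR c x = Dual (c * std_part x) (c * inf_part x)"

instance
  by standard
    (auto simp: plus_dual_def times_dual_def one_dual_def scaleR_dual_def algebra_simps)

end

lemma of_real_dual: "of_real c = Dual c 0"
  by (simp add: of_real_def scaleR_dual_def one_dual_def)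

definition eps :: dual ("\<epsilon>") where "\<epsilon> = Dual 0 1"

lemma eps_nonzero: "\<epsilon> \<noteq> 0"
  by (simp add: eps_def zero_dual_def)

lemma eps_square: "\<epsilon> ^ 2 = 0"
  by (simp add: eps_def zero_dual_def times_dual_def power2_eq_square)

lemma dual_decompose: "x = of_real (std_part x) + of_real (inf_part x) * \<epsilon>"
  by (simp add: dual_eq_iff of_real_dual eps_def plus_dual_def times_dual_def)

text \<open>Division is meaningful only when the standard part of the denominator is nonzero; these are
  exactly the invertible dual numbers.\<close>

instantiation dual :: inverse
begin

definition "inverse x = Dual (inverse (std_part x)) (- inf_part x / (std_part x)\<^sup>2)"
definition "x div y = Dual (std_part x / std_part y)
   ((inf_part x * std_part y - std_part x * inf_part y) / (std_part y)\<^sup>2)"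

instance ..

end

lemma dual_mult_inverse: "std_part x \<noteq> 0 \<Longrightarrow> x * inverse x = 1"
  by (simp add: times_dual_def inverse_dual_def one_dual_def field_simps power2_eq_square)

lemma dual_divide_inverse: "std_part y \<noteq> 0 \<Longrightarrow> x / y = x * inverse (y :: dual)"
  by (simp add: times_dual_def inverse_dual_def divide_dual_def field_simps power2_eq_square)

lemma dual_dvd_1_iff: "(x :: dual) dvd 1 \<longleftrightarrow> std_part x \<noteq> 0"
proof
  assume "x dvd 1"
  then obtain y where "1 = x * y" by (elim dvdE)
  then show "std_part x \<noteq> 0"
    by (auto simp: times_dual_def one_dual_def)
next
  assume "std_part x \<noteq> 0"
  then have "1 = x * inverse x" by (simp add: dual_mult_inverse)
  then show "x dvd 1" by (rule dvdI)
qed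

text \<open>The usual total order on dual numbers is lexicographic.\<close>

instantiation dual :: linorder
begin

definition "x < y \<longleftrightarrow>
  std_part x < std_part y \<or> std_part x = std_part y \<and> inf_part x < inf_part y"
definition "x \<le> y \<longleftrightarrow> x < y \<or> x = (y :: dual)"

instance
  by standard (auto simp: less_dual_def less_eq_dual_def dual_eq_iff)

end

section \<open>Graphs and Laplacian matrices\<close>

text \<open>The vertex set is \<open>{0..<n}\<close>, to agree with the indexing of \<open>'a mat\<close>.\<close>

definition simple_graph :: "nat \<Rightarrow> nat set set \<Rightarrow> bool" where
  "simple_graph n E \<longleftrightarrow> (\<forall>e\<in>E. \<exists>i<n. \<exists>j<n. i \<noteq> j \<and> e = {i, j})"

definition connected_graph :: "nat \<Rightarrow> nat set set \<Rightarrow> bool" where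
  "connected_graph n E \<longleftrightarrow> simple_graph n E \<and> n > 0 \<and>
     (\<forall>i<n. \<forall>j<n. (i, j) \<in> {(u, v). {u, v} \<in> E}\<^sup>*)"

definition adj_matrix :: "nat \<Rightarrow> nat set set \<Rightarrow> (nat set \<Rightarrow> 'a::comm_ring_1) \<Rightarrow> 'a mat" where
  "adj_matrix n E w = mat n n (\<lambda>(i, j). if {i, j} \<in> E then w {i, j} else 0)"

definition deg_matrix :: "nat \<Rightarrow> nat set set \<Rightarrow> (nat set \<Rightarrow> 'a::comm_ring_1) \<Rightarrow> 'a mat" where
  "deg_matrix n E w =
     mat n n (\<lambda>(i, j). if i = j then \<Sum>k<n. adj_matrix n E w $$ (i, k) else 0)"

text \<open>With edge weights \<open>w\<close>, this is \<open>L\<close> for \<open>w = (\<lambda>_. 1)\<close> over the reals, the perturbation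
  Laplacian for the real perturbations \<open>w = a\<close>, and \<open>L\<^sub>w\<close> for the dual conductances below.\<close>

definition laplacian :: "nat \<Rightarrow> nat set set \<Rightarrow> (nat set \<Rightarrow> 'a::comm_ring_1) \<Rightarrow> 'a mat" where
  "laplacian n E w = deg_matrix n E w - adj_matrix n E w"

definition dual_weight :: "(nat set \<Rightarrow> real) \<Rightarrow> nat set \<Rightarrow> dual" where
  "dual_weight a e = 1 + of_real (a e) * \<epsilon>"

lemma laplacian_dual_weight:
  "laplacian n E (dual_weight a) =
     map_mat of_real (laplacian n E (\<lambda>_. 1)) + \<epsilon> \<cdot>\<^sub>m map_mat of_real (laplacian n E a)"
proof (rule eq_matI, goal_cases)
  case (1 i j)
  have "(\<Sum>k<n. if {i, k} \<in> E then dual_weight a {i, k} else 0) =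
    of_real (\<Sum>k<n. if {i, k} \<in> E then 1 else 0) +
    \<epsilon> * of_real (\<Sum>k<n. if {i, k} \<in> E then a {i, k} else 0)" for i
    unfolding of_real_sum sum_distrib_left sum.distrib[symmetric]
    by (rule sum.cong) (simp_all add: dual_weight_def mult.commute)
  with 1 show ?case
    by (simp add: laplacian_def deg_matrix_def adj_matrix_def dual_weight_def algebra_simps)
qed (simp_all add: laplacian_def deg_matrix_def adj_matrix_def)

section \<open>Resistance distance and Kirchhoff index\<close>

text \<open>The net current \<open>Y\<close> is required to be invertible so that the division by \<open>Y\<close> makes sense: this
  is automatic for a positive real, and excludes positive infinitesimals among the dual numbers.
  For connected graphs with weights \<open>1\<close> or \<open>dual_weight a\<close>, the potentials \<open>v\<close> exist and the
  resulting quotient depends neither on \<open>v\<close> nor on \<open>Y\<close>.\<close>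

definition resistance ::
  "nat \<Rightarrow> nat set set \<Rightarrow> (nat set \<Rightarrow> 'a::{comm_ring_1,inverse,ord}) \<Rightarrow> nat \<Rightarrow> nat \<Rightarrow> 'a" where
  "resistance n E w i j = (if i = j then 0 else
     (THE r. \<exists>Y v. Y > 0 \<and> Y dvd 1 \<and> v \<in> carrier_vec n \<and>
        laplacian n E w *\<^sub>v v = Y \<cdot>\<^sub>v (unit_vec n i - unit_vec n j) \<and>
        r = (v $ i - v $ j) / Y))"

definition kirchhoff_index ::
  "nat \<Rightarrow> nat set set \<Rightarrow> (nat set \<Rightarrow> 'a::{comm_ring_1,inverse,ord}) \<Rightarrow> 'a" where
  "kirchhoff_index n E w = (\<Sum>j<n. \<Sum>i<j. resistance n E w i j)"

definition kirchhoff_perturbation :: "nat \<Rightarrow> nat set set \<Rightarrow> (nat set \<Rightarrow> real) \<Rightarrow> real" where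
  "kirchhoff_perturbation n E a =
     inf_part (kirchhoff_index n E (dual_weight a) - of_real (kirchhoff_index n E (\<lambda>_. 1)))"

section \<open>Eigenvalues\<close>

text \<open>\<open>f 1, \<dots>, f n\<close> are the eigenvalues of \<open>A\<close>, listed with algebraic multiplicity.\<close>

definition eigenvalue_listing :: "real mat \<Rightarrow> nat \<Rightarrow> (nat \<Rightarrow> real) \<Rightarrow> bool" where
  "eigenvalue_listing A n f \<longleftrightarrow> char_poly A = (\<Prod>i=1..n. [:- f i, 1:])"

text \<open>The library defines the spectral radius for complex matrices.\<close>

definition real_spectral_radius :: "real mat \<Rightarrow> real" where
  "real_spectral_radius A = spectral_radius (map_mat complex_of_real A)"

end

theory Submission
  imports Defs
begin

text \<open>Let \<open>q\<^sub>1, \<dots>, q\<^sub>n\<close> be an orthonormal eigenbasis of \<open>L\<close>. For a connected graph only \<open>\<lambda>\<^sub>n\<close> vanishes, and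
  \<open>q\<^sub>n\<close> is constant. If \<open>L x = e\<^sub>i - e\<^sub>j\<close> and \<open>L y = M x\<close> with \<open>M\<close> the perturbation Laplacian, then
  \<open>x - y \<epsilon>\<close> is a dual potential for a unit current, and self-adjointness of \<open>L\<close> gives \<open>- x\<^sup>T M x\<close> for the
  infinitesimal part of the resistance. Expanding \<open>x\<close> in the \<open>q\<^sub>k\<close> and summing over all pairs
  \<open>i < j\<close> shows that the Kirchhoff index changes by \<open>- n (\<Sum>k<n. q\<^sub>k\<^sup>T M q\<^sub>k / \<lambda>\<^sub>k\<^sup>2)\<close>. With an orthonormal
  eigenbasis \<open>u\<^sub>p\<close> of \<open>M\<close> one has \<open>q\<^sub>k\<^sup>T M q\<^sub>k = (\<Sum>p. \<mu>\<^sub>p (u\<^sub>p\<^sup>T q\<^sub>k)\<^sup>2)\<close>, where the squares form a doubly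
  stochastic matrix: bounding \<open>\<lambda>\<^sub>k\<close> by \<open>\<lambda>\<^sub>n\<^sub>-\<^sub>1\<close> gives (a), and bounding \<open>\<mu>\<^sub>p\<close> by the spectral radius
  gives (b).\<close>

section \<open>Real symmetric matrices\<close>

text \<open>Since \<open>v\<close> and the first basis vector \<open>e0\<close> have equal length,
  reflecting in the hyperplane orthogonal to \<open>w = v - e0\<close> swaps them; this is
  \<open>1 - (2 / s) w w^T\<close> with \<open>s = w \<bullet> w\<close>. For \<open>v = e0\<close>
  the vector \<open>w\<close> vanishes and the identity serves.\<close>

lemma householder_reflection:
  fixes v :: "real vec"
  assumes v: "v \<in> carrier_vec n" and unit: "v \<bullet> v = 1" and n: "0 < n"
  obtains H where "H \<in> carrier_mat n n" "transpose_mat H = H" "H * H = 1\<^sub>m n"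
    "H *\<^sub>v unit_vec n 0 = v"
proof (cases "v = unit_vec n 0")
  case True
  then show ?thesis using that[of "1\<^sub>m n"] by auto
next
  case False
  define w where "w = v - unit_vec n 0"
  have w: "w \<in> carrier_vec n" using v by (simp add: w_def)
  have w_index: "w $ i = v $ i - (if i = 0 then 1 else 0)" if "i < n" for i
    using that v n by (simp add: w_def)
  define s where "s = w \<bullet> w"
  have "w \<noteq> 0\<^sub>v n"
  proof
    assume "w = 0\<^sub>v n"
    then have "v $ i = unit_vec n 0 $ i" if "i < n" for i
      using w_index[OF that] that by auto
    then show False using False v by auto
  qed
  then have s0: "s \<noteq> 0"
    using conjugate_square_eq_0_vec[OF w] unfolding s_def by simp
  have s_sum: "(\<Sum>k<n. w $ k * w $ k) = s"
    using w by (simp add: s_def scalar_prod_def atLeast0LessThan)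
  \<comment> \<open>Unit length of \<open>v\<close> turns \<open>|v - e0|^2\<close> into
    \<open>2 - 2 v0\<close>.\<close>
  have "s = (\<Sum>k<n. v $ k * v $ k - (if k = 0 then 2 * v $ k - 1 else 0))"
    unfolding s_sum[symmetric] by (rule sum.cong) (auto simp: w_index algebra_simps)
  also have "\<dots> = v \<bullet> v - (2 * v $ 0 - 1)"
    using n v by (simp add: sum_subtractf scalar_prod_def atLeast0LessThan)
  finally have s_v: "s = 2 - 2 * v $ 0" by (simp add: unit)
  define H where "H = mat n n (\<lambda>(i, j). (if i = j then 1 else 0) - 2 / s * w $ i * w $ j)"
  have H: "H \<in> carrier_mat n n" by (simp add: H_def)
  have "transpose_mat H = H"
    by (rule eq_matI) (auto simp: H_def)
  moreover have "H * H = 1\<^sub>m n"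
  proof (rule eq_matI)
    fix i j assume "i < dim_row (1\<^sub>m n :: real mat)" "j < dim_col (1\<^sub>m n :: real mat)"
    then have i: "i < n" and j: "j < n" by auto
    let ?d = "\<lambda>i j :: nat. if i = j then 1 else (0::real)"
    have "(H * H) $$ (i, j) =
      (\<Sum>k<n. (?d i k - 2 / s * w $ i * w $ k) * (?d k j - 2 / s * w $ k * w $ j))"
      using i j by (simp add: H_def scalar_prod_def atLeast0LessThan)
    also have "\<dots> = (\<Sum>k<n. (if k = i then ?d i j else 0)
       - (if k = i then 2 / s * w $ i * w $ j else 0) - (if k = j then 2 / s * w $ i * w $ j else 0)
       + 4 / s\<^sup>2 * w $ i * w $ j * (w $ k * w $ k))"
      by (rule sum.cong) (auto simp: algebra_simps power2_eq_square)
    also have "\<dots> = ?d i j - 4 / s * w $ i * w $ j + 4 / s\<^sup>2 * w $ i * w $ j * s"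
      using i j unfolding sum.distrib sum_subtractf sum_distrib_left[symmetric] s_sum by simp
    also have "\<dots> = ?d i j" using s0 by (simp add: power2_eq_square)
    finally show "(H * H) $$ (i, j) = 1\<^sub>m n $$ (i, j)" using i j by simp
  qed (auto simp: H_def)
  moreover have "H *\<^sub>v unit_vec n 0 = v"
  proof (rule eq_vecI)
    fix i assume "i < dim_vec v"
    then have i: "i < n" using v by auto
    \<comment> \<open>This value makes the coefficient of \<open>w\<close> in \<open>H e0\<close>
      equal to one, so \<open>H e0 = e0 + w = v\<close>.\<close>
    have "w $ 0 = - s / 2" using n by (simp add: w_index s_v)
    then have "2 / s * w $ i * w $ 0 = - w $ i" using s0 by simp
    moreover have "(H *\<^sub>v unit_vec n 0) $ i = (if i = 0 then 1 else 0) - 2 / s * w $ i * w $ 0"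
      using i n H by (simp add: H_def)
    ultimately show "(H *\<^sub>v unit_vec n 0) $ i = v $ i" using i w_index by simp
  qed (use v in \<open>auto simp: H_def\<close>)
  ultimately show ?thesis using that[OF H] by blast
qed

text \<open>A Householder reflection sending the first basis vector to a unit eigenvector deflates the
  matrix; unlike a general Gram--Schmidt basis change it is symmetric and its own inverse.\<close>

lemma real_symmetric_spectral:
  fixes A :: "real mat"
  assumes "A \<in> carrier_mat n n" and "transpose_mat A = A"
    and "char_poly A = (\<Prod>e\<leftarrow>es. [:- e, 1:])"
  shows "\<exists>U\<in>carrier_mat n n. transpose_mat U * U = 1\<^sub>m n \<and> A * U = U * mat_diag n (\<lambda>i. es ! i)"
  using assms
proof (induction es arbitrary: n A)
  case Nil
  with degree_monic_char_poly[of A n] have "n = 0" by simp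
  with Nil show ?case by (intro bexI[of _ "1\<^sub>m 0"] conjI eq_matI) (auto simp: mat_diag_def)
next
  case (Cons e es n A)
  note A = Cons.prems(1) and sym = Cons.prems(2)
  have cp: "char_poly A = [:- e, 1:] * (\<Prod>e\<leftarrow>es. [:- e, 1:])" using Cons.prems by simp
  have mon: "monic (\<Prod>e\<leftarrow>es. [:- e, 1:])" by (rule monic_prod_list) auto
  have "degree (char_poly A) = Suc (degree (\<Prod>e\<leftarrow>es. [:- e, 1:]))"
    unfolding cp by (subst degree_mult_eq, insert mon, auto)
  with degree_monic_char_poly[OF A] obtain m where n: "n = Suc m" by (cases n) auto
  have "eigenvalue A e" unfolding eigenvalue_root_char_poly[OF A] cp by simp
  then obtain v0 where v0: "v0 \<in> carrier_vec n" "v0 \<noteq> 0\<^sub>v n" "A *\<^sub>v v0 = e \<cdot>\<^sub>v v0"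
    using A unfolding eigenvalue_def eigenvector_def by auto
  have "v0 \<bullet> v0 \<noteq> 0" using conjugate_square_eq_0_vec[OF v0(1)] v0(2) by simp
  moreover have "v0 \<bullet> v0 \<ge> 0" using conjugate_square_ge_0_vec[of v0] by simp
  ultimately have pos: "v0 \<bullet> v0 > 0" by simp
  define v where "v = (1 / sqrt (v0 \<bullet> v0)) \<cdot>\<^sub>v v0"
  have v: "v \<in> carrier_vec n" using v0 by (simp add: v_def)
  have vv: "v \<bullet> v = 1" using v0(1) pos by (simp add: v_def)
  have Av: "A *\<^sub>v v = e \<cdot>\<^sub>v v"
    using v0 A by (simp add: v_def mult_mat_vec smult_smult_assoc mult.commute)
  obtain H where H: "H \<in> carrier_mat n n" "transpose_mat H = H" "H * H = 1\<^sub>m n"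
    "H *\<^sub>v unit_vec n 0 = v"
    using householder_reflection[OF v vv] n by auto
  define A' where "A' = H * A * H"
  have A': "A' \<in> carrier_mat n n" using A H by (simp add: A'_def)
  have A'_sym: "transpose_mat A' = A'"
    using A H sym unfolding A'_def by (simp add: transpose_mult[of _ n n _ n])
  have "similar_mat_wit A' A H H"
    by (rule similar_mat_witI[of _ _ n]) (use A A' H in \<open>auto simp: A'_def\<close>)
  then have sim: "similar_mat A' A" unfolding similar_mat_def by blast
  have Hv: "H *\<^sub>v v = unit_vec n 0"
    using H by (metis assoc_mult_mat_vec one_mult_mat_vec unit_vec_carrier)
  \<comment> \<open>Column 0 of \<open>A'\<close> is \<open>H A H e0 = H A v = e H v = e e0\<close>;
    symmetry transfers this to row 0, leaving a block-diagonal matrix.\<close>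
  have "A' *\<^sub>v unit_vec n 0 = e \<cdot>\<^sub>v unit_vec n 0"
    using A H v unfolding A'_def
    by (simp add: assoc_mult_mat_vec[of _ n n _ n] mult_mat_vec[of H n n v] Av Hv)
  then have "(A' *\<^sub>v unit_vec n 0) $ i = (e \<cdot>\<^sub>v unit_vec n 0) $ i" for i by simp
  moreover have "(A' *\<^sub>v unit_vec n 0) $ i = A' $$ (i, 0)" if "i < n" for i
    using that n A' by simp
  ultimately have col0: "A' $$ (i, 0) = (if i = 0 then e else 0)" if "i < n" for i
    using that n by (metis index_smult_vec(1) index_unit_vec(1,3) mult.right_neutral mult_zero_right zero_less_Suc)
  have row0: "A' $$ (0, i) = (if i = 0 then e else 0)" if "i < n" for i
    using col0[OF that] A'_sym A' that n by (metis carrier_matD index_transpose_mat(1) zero_less_Suc)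
  define A1 where "A1 = mat 1 1 (\<lambda>_. e)"
  define A3 where "A3 = mat m m (\<lambda>(i, j). A' $$ (Suc i, Suc j))"
  have A1: "A1 \<in> carrier_mat 1 1" and A3: "A3 \<in> carrier_mat m m" by (auto simp: A1_def A3_def)
  have block: "A' = four_block_mat A1 (0\<^sub>m 1 m) (0\<^sub>m m 1) A3"
    by (rule eq_matI) (use A' n col0 row0 in \<open>auto simp: A1_def A3_def\<close>)
  have A3_sym: "transpose_mat A3 = A3"
  proof (rule eq_matI)
    fix i j assume "i < dim_row A3" "j < dim_col A3"
    then show "transpose_mat A3 $$ (i, j) = A3 $$ (i, j)"
      using A' n arg_cong[OF A'_sym, of "\<lambda>M. M $$ (Suc i, Suc j)"] by (simp add: A3_def)
  qed (auto simp: A3_def)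
  \<comment> \<open>Similarity preserves the characteristic polynomial and the block form splits off
    the factor for \<open>e\<close>; cancelling it makes the induction hypothesis applicable to
    \<open>A3\<close>.\<close>
  have "[:- e, 1:] * (\<Prod>e\<leftarrow>es. [:- e, 1:]) = char_poly A'"
    using cp char_poly_similar[OF sim] by simp
  also have "\<dots> = char_poly A1 * char_poly A3"
    unfolding block by (rule char_poly_four_block_zeros_col[OF A1 _ A3]) simp
  also have "char_poly A1 = [:- e, 1:]"
    by (simp add: A1_def char_poly_defs det_def sign_def)
  finally have "char_poly A3 = (\<Prod>e\<leftarrow>es. [:- e, 1:])"
    by (metis mult_cancel_left pCons_eq_0_iff zero_neq_one)
  from Cons.IH[OF A3 A3_sym this] obtain U where
    U: "U \<in> carrier_mat m m" "transpose_mat U * U = 1\<^sub>m m" "A3 * U = U * mat_diag m (\<lambda>i. es ! i)"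
    by blast
  let ?U = "four_block_mat (1\<^sub>m 1) (0\<^sub>m 1 m) (0\<^sub>m m 1) U"
  have U': "?U \<in> carrier_mat n n" using U n by auto
  have U'_orth: "transpose_mat ?U * ?U = 1\<^sub>m n"
    using U n
    by (simp add: transpose_four_block_mat[of _ 1 1 _ m _ m] mult_four_block_mat[of _ 1 1 _ m _ m _ _ 1 _ m] )
  have diag: "mat_diag n (\<lambda>i. (e # es) ! i) =
      four_block_mat A1 (0\<^sub>m 1 m) (0\<^sub>m m 1) (mat_diag m (\<lambda>i. es ! i))"
    by (rule eq_matI) (auto simp: n A1_def mat_diag_def)
  have A'U: "A' * ?U = ?U * mat_diag n (\<lambda>i. (e # es) ! i)"
    unfolding block diag using U A1 A3
    by (simp add: left_mult_zero_mat[OF mat_diag_dim] mult_four_block_mat[of _ 1 1 _ m _ m _ _ 1 _ m])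
  have "H * (H * ?U) = ?U"
    using assoc_mult_mat[of H n n H n ?U n, symmetric] left_mult_one_mat[OF U'] H U' by simp
  then have "transpose_mat (H * ?U) * (H * ?U) = 1\<^sub>m n"
    using H U' U'_orth by (simp add: transpose_mult[of _ n n _ n] assoc_mult_mat[of _ n n _ n _ n])
  \<comment> \<open>As \<open>H\<close> is its own inverse, a matrix \<open>?U\<close> that
    diagonalizes \<open>A'\<close> yields \<open>H * ?U\<close> for \<open>A\<close>.\<close>
  moreover have "H * A' = A * H"
    using A H assoc_mult_mat[of H n n H n "A * H" n, symmetric]
    by (simp add: A'_def assoc_mult_mat[of H n n A n H n])
  then have "A * (H * ?U) = H * (A' * ?U)"
    using A H A' U' assoc_mult_mat[of A n n H n ?U n] assoc_mult_mat[of H n n A' n ?U n] by simp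
  then have "A * (H * ?U) = H * ?U * mat_diag n (\<lambda>i. (e # es) ! i)"
    unfolding A'U using assoc_mult_mat[OF H(1) U' mat_diag_dim] by simp
  ultimately show ?case using H U' by (intro bexI[of _ "H * ?U"]) auto
qed

text \<open>The vectors \<open>q k\<close> are the columns of an orthogonal \<open>U\<close>.
  Because \<open>U\<close> is square, its rows are orthonormal as well, which is the completeness
  relation in the second conclusion. \<open>Suc\<close> reconciles matrix indices from 0 with
  listings from 1.\<close>

lemma symmetric_eigenbasis:
  fixes A :: "real mat"
  assumes A: "A \<in> carrier_mat n n" and sym: "transpose_mat A = A" and ev: "eigenvalue_listing A n f"
  obtains q :: "nat \<Rightarrow> nat \<Rightarrow> real" where
    "\<And>k l. k < n \<Longrightarrow> l < n \<Longrightarrow> (\<Sum>i<n. q k i * q l i) = (if k = l then 1 else 0)"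
    "\<And>i j. i < n \<Longrightarrow> j < n \<Longrightarrow> (\<Sum>k<n. q k i * q k j) = (if i = j then 1 else 0)"
    "\<And>k i. k < n \<Longrightarrow> i < n \<Longrightarrow> (\<Sum>j<n. A $$ (i, j) * q k j) = f (Suc k) * q k i"
proof -
  let ?es = "map (\<lambda>k. f (Suc k)) [0..<n]"
  have "char_poly A = (\<Prod>e\<leftarrow>?es. [:- e, 1:])"
    using ev unfolding eigenvalue_listing_def
    by (simp add: prod.atLeast1_atMost_eq prod.distinct_set_conv_list[of "[0..<n]", symmetric] comp_def atLeast0LessThan)
  from real_symmetric_spectral[OF A sym this] obtain U where
    U: "U \<in> carrier_mat n n" "transpose_mat U * U = 1\<^sub>m n"
      "A * U = U * mat_diag n (\<lambda>i. ?es ! i)" by blast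
  have UU: "U * transpose_mat U = 1\<^sub>m n"
    using mat_mult_left_right_inverse[OF _ U(1) U(2)] U(1) by simp
  show ?thesis
  proof (rule that[of "\<lambda>k i. U $$ (i, k)"])
    fix k l assume "k < n" "l < n"
    then show "(\<Sum>i<n. U $$ (i, k) * U $$ (i, l)) = (if k = l then 1 else 0)"
      using U(1) arg_cong[OF U(2), of "\<lambda>M. M $$ (k, l)"]
      by (simp add: scalar_prod_def atLeast0LessThan)
  next
    fix i j assume "i < n" "j < n"
    then show "(\<Sum>k<n. U $$ (i, k) * U $$ (j, k)) = (if i = j then 1 else 0)"
      using U(1) arg_cong[OF UU, of "\<lambda>M. M $$ (i, j)"]
      by (simp add: scalar_prod_def atLeast0LessThan)
  next
    fix k i assume "k < n" "i < n"
    then show "(\<Sum>j<n. A $$ (i, j) * U $$ (j, k)) = f (Suc k) * U $$ (i, k)"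
      using U(1) A arg_cong[OF U(3), of "\<lambda>M. M $$ (i, k)"]
      by (simp add: scalar_prod_def atLeast0LessThan mat_diag_mult_right)
  qed
qed

section \<open>Laplacians and dual resistances\<close>

text \<open>Turns the Kirchhoff sum over \<open>i < j\<close> into half a sum over all ordered
  pairs, where orthogonality of eigenvectors can be used.\<close>

lemma sum_lower_triangle:
  fixes f :: "nat \<Rightarrow> nat \<Rightarrow> 'a::comm_ring_1"
  assumes "\<And>i j. f i j = f j i" and "\<And>i. f i i = 0"
  shows "2 * (\<Sum>j<n. \<Sum>i<j. f i j) = (\<Sum>i<n. \<Sum>j<n. f i j)"
proof (induction n)
  case (Suc n)
  have "(\<Sum>i<n. f i n) = (\<Sum>i<n. f n i)" using assms(1) by simp
  with Suc show ?case by (simp add: sum.distrib algebra_simps assms(2))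
qed simp

lemma inf_part_sum: "inf_part (sum f A) = (\<Sum>x\<in>A. inf_part (f x))"
  by (induction A rule: infinite_finite_induct) (simp_all add: zero_dual_def plus_dual_def)

lemma std_part_sum: "std_part (sum f A) = (\<Sum>x\<in>A. std_part (f x))"
  by (induction A rule: infinite_finite_induct) (simp_all add: zero_dual_def plus_dual_def)

section \<open>Symmetry, energy and kernel of the Laplacian\<close>

lemma laplacian_carrier: "laplacian n E w \<in> carrier_mat n n"
  by (auto simp: laplacian_def deg_matrix_def adj_matrix_def)

lemma transpose_laplacian: "transpose_mat (laplacian n E w) = laplacian n E w"
  by (rule eq_matI) (auto simp: laplacian_def deg_matrix_def adj_matrix_def insert_commute)

lemma laplacian_symmetric:
  "i < n \<Longrightarrow> j < n \<Longrightarrow> laplacian n E w $$ (i, j) = laplacian n E w $$ (j, i)"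
  using laplacian_carrier[of n E w] transpose_laplacian[of n E w]
  by (metis carrier_matD index_transpose_mat(1))

lemma laplacian_apply:
  assumes "i < n"
  shows "(\<Sum>j<n. laplacian n E w $$ (i, j) * x j) =
    (\<Sum>j<n. (if {i, j} \<in> E then w {i, j} else 0) * (x i - x j))"
proof -
  let ?c = "\<lambda>j. if {i, j} \<in> E then w {i, j} else 0"
  have "(\<Sum>j<n. laplacian n E w $$ (i, j) * x j) =
      (\<Sum>j<n. (if j = i then (\<Sum>k<n. ?c k) * x i else 0) - ?c j * x j)"
    using assms by (intro sum.cong)
      (auto simp: laplacian_def deg_matrix_def adj_matrix_def left_diff_distrib)
  also have "\<dots> = (\<Sum>k<n. ?c k) * x i - (\<Sum>j<n. ?c j * x j)"
    using assms by (simp add: sum_subtractf)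
  finally show ?thesis
    by (simp add: sum_subtractf right_diff_distrib sum_distrib_right)
qed

lemma laplacian_self_adjoint:
  "(\<Sum>i<n. y i * (\<Sum>j<n. laplacian n E w $$ (i, j) * x j)) =
   (\<Sum>i<n. x i * (\<Sum>j<n. laplacian n E w $$ (i, j) * y j))"
proof -
  have "(\<Sum>i<n. y i * (\<Sum>j<n. laplacian n E w $$ (i, j) * x j)) =
      (\<Sum>i<n. \<Sum>j<n. x j * (laplacian n E w $$ (j, i) * y i))"
    unfolding sum_distrib_left
    by (intro sum.cong) (auto simp: laplacian_symmetric[of _ n _ E w] algebra_simps)
  then show ?thesis unfolding sum_distrib_left by (subst (asm) sum.swap)
qed

text \<open>The weights depend only on the unordered pair, so exchanging \<open>i\<close> and
  \<open>j\<close> in the double sum and adding both copies produces squares. Every edge is then met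
  twice, hence the factor 2.\<close>

lemma laplacian_quadratic_form:
  fixes x :: "nat \<Rightarrow> real"
  shows "2 * (\<Sum>i<n. x i * (\<Sum>j<n. laplacian n E w $$ (i, j) * x j)) =
    (\<Sum>i<n. \<Sum>j<n. (if {i, j} \<in> E then w {i, j} else 0) * (x i - x j)\<^sup>2)"
proof -
  let ?c = "\<lambda>i j. if {i, j} \<in> E then w {i, j} else 0"
  let ?S = "\<Sum>i<n. \<Sum>j<n. x i * (?c i j * (x i - x j))"
  have eq: "(\<Sum>i<n. x i * (\<Sum>j<n. laplacian n E w $$ (i, j) * x j)) = ?S"
    by (simp add: laplacian_apply sum_distrib_left)
  have "?S = (\<Sum>j<n. \<Sum>i<n. x i * (?c i j * (x i - x j)))" by (rule sum.swap)
  also have "\<dots> = (\<Sum>i<n. \<Sum>j<n. x j * (?c i j * (x j - x i)))"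
    by (intro sum.cong refl) (auto simp: insert_commute)
  finally have "2 * ?S = ?S + (\<Sum>i<n. \<Sum>j<n. x j * (?c i j * (x j - x i)))" by simp
  also have "\<dots> = (\<Sum>i<n. \<Sum>j<n. ?c i j * (x i - x j)\<^sup>2)"
    unfolding sum.distrib[symmetric]
    by (intro sum.cong refl) (simp add: power2_eq_square algebra_simps)
  finally show ?thesis unfolding eq .
qed

text \<open>With unit weights the energy is a sum of squares. If it vanishes, \<open>x\<close>
  agrees across every edge, and connectedness carries the equality along paths.\<close>

lemma laplacian_kernel_constant:
  fixes x :: "nat \<Rightarrow> real"
  assumes conn: "connected_graph n E"
    and ker: "\<And>i. i < n \<Longrightarrow> (\<Sum>j<n. laplacian n E (\<lambda>_. 1) $$ (i, j) * x j) = 0"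
    and i: "i < n" and j: "j < n"
  shows "x i = x j"
proof -
  let ?t = "\<lambda>i j. (if {i, j} \<in> E then 1 else 0) * (x i - x j)\<^sup>2"
  have "(\<Sum>i<n. \<Sum>j<n. ?t i j) = 0"
    unfolding laplacian_quadratic_form[where x = x and n = n and E = E and w = "\<lambda>_. 1", symmetric] using ker by simp
  moreover have "(\<Sum>j<n. ?t i j) \<ge> 0" for i by (intro sum_nonneg) auto
  ultimately have "(\<Sum>j<n. ?t i j) = 0" if "i < n" for i
    using that by (subst (asm) sum_nonneg_eq_0_iff) auto
  then have "?t i j = 0" if "i < n" "j < n" for i j
    using that by (subst (asm) sum_nonneg_eq_0_iff) (auto split: if_splits)
  then have edge: "x i = x j" if "i < n" "j < n" "{i, j} \<in> E" for i j
    using that by fastforce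
  \<comment> \<open>Inner vertices of a path must lie below \<open>n\<close> before
    \<open>edge\<close> applies to them.\<close>
  have verts: "u < n \<and> v < n" if "{u, v} \<in> E" for u v
    using conn that unfolding connected_graph_def simple_graph_def
    by (metis doubleton_eq_iff)
  have "(i, j) \<in> {(u, v). {u, v} \<in> E}\<^sup>*" using conn i j unfolding connected_graph_def by blast
  then show ?thesis
    by induction (use edge verts in auto)
qed

lemma laplacian_mult_constant:
  assumes "i < n"
  shows "(\<Sum>j<n. laplacian n E w $$ (i, j)) = 0"
  using laplacian_apply[OF assms, of E w "\<lambda>_. 1"] by simp

text \<open>Pairing any other potential \<open>u\<close> for the current \<open>Y\<close> with \<open>v\<close> gives \<open>u i - u j = Y (v i - v j)\<close>
  because the Laplacian is self-adjoint, so the quotient is unique without knowing its kernel.\<close>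

lemma resistance_dual_eqI:
  fixes w :: "nat set \<Rightarrow> dual"
  assumes ij: "i \<noteq> j" "i < n" "j < n"
    and v: "\<And>k. k < n \<Longrightarrow> (\<Sum>l<n. laplacian n E w $$ (k, l) * v l) =
      (if k = i then 1 else 0) - (if k = j then 1 else 0)"
  shows "resistance n E w i j = v i - v j"
proof -
  let ?L = "laplacian n E w"
  let ?P = "\<lambda>r. \<exists>Y u. Y > 0 \<and> Y dvd 1 \<and> u \<in> carrier_vec n \<and>
        ?L *\<^sub>v u = Y \<cdot>\<^sub>v (unit_vec n i - unit_vec n j) \<and> r = (u $ i - u $ j) / Y"
  have "?P (v i - v j)"
  proof (intro exI[of _ 1] exI[of _ "vec n v"] conjI)
    show "?L *\<^sub>v vec n v = 1 \<cdot>\<^sub>v (unit_vec n i - unit_vec n j)"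
      by (rule eq_vecI)
        (use v ij laplacian_carrier[of n E w] in \<open>auto simp: scalar_prod_def atLeast0LessThan\<close>)
    show "v i - v j = (vec n v $ i - vec n v $ j) / 1"
      using ij by (simp add: divide_dual_def one_dual_def)
  qed (auto simp: less_dual_def one_dual_def zero_dual_def)
  moreover have "r = v i - v j" if "?P r" for r
  proof -
    from that obtain Y u where Y: "Y dvd 1" and u: "u \<in> carrier_vec n"
      and Lu: "?L *\<^sub>v u = Y \<cdot>\<^sub>v (unit_vec n i - unit_vec n j)" and r: "r = (u $ i - u $ j) / Y"
      by blast
    have Lu': "(\<Sum>l<n. ?L $$ (k, l) * u $ l) = Y * ((if k = i then 1 else 0) - (if k = j then 1 else 0))"
      if "k < n" for k
      using arg_cong[OF Lu, of "\<lambda>x. x $ k"] that ij u laplacian_carrier[of n E w]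
      by (simp add: scalar_prod_def atLeast0LessThan)
    have pair: "(\<Sum>k<n. x k * (c * ((if k = i then 1 else 0) - (if k = j then 1 else 0)))) = c * (x i - x j)"
      for x :: "nat \<Rightarrow> dual" and c
    proof -
      have "(\<Sum>k<n. x k * (c * ((if k = i then 1 else 0) - (if k = j then 1 else 0)))) =
        (\<Sum>k<n. (if k = i then c * x i else 0) - (if k = j then c * x j else 0))"
        by (intro sum.cong) auto
      then show ?thesis using ij by (simp add: sum_subtractf right_diff_distrib)
    qed
    have "(\<Sum>k<n. u $ k * (1 * ((if k = i then 1 else 0) - (if k = j then 1 else 0)))) =
        (\<Sum>k<n. v k * (Y * ((if k = i then 1 else 0) - (if k = j then 1 else 0))))"
      using laplacian_self_adjoint[of "\<lambda>k. u $ k" n E w v] v Lu' by simp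
    then have "u $ i - u $ j = Y * (v i - v j)" unfolding pair by simp
    moreover have "std_part Y \<noteq> 0" using Y by (simp add: dual_dvd_1_iff)
    ultimately show ?thesis
      unfolding r by (metis dual_divide_inverse dual_mult_inverse mult.commute mult.left_commute mult_1)
  qed
  ultimately have "(THE r. ?P r) = v i - v j" by (rule the_equality)
  then show ?thesis using ij by (simp add: resistance_def)
qed

lemma inf_part_resistance:
  assumes ij: "i \<noteq> j" "i < n" "j < n"
    and x: "\<And>k. k < n \<Longrightarrow> (\<Sum>l<n. laplacian n E (\<lambda>_. 1) $$ (k, l) * x l) =
      (if k = i then 1 else 0) - (if k = j then 1 else 0)"
    and y: "\<And>k. k < n \<Longrightarrow> (\<Sum>l<n. laplacian n E (\<lambda>_. 1) $$ (k, l) * y l) =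
      (\<Sum>l<n. laplacian n E a $$ (k, l) * x l)"
  shows "inf_part (resistance n E (dual_weight a) i j) =
    - (\<Sum>k<n. x k * (\<Sum>l<n. laplacian n E a $$ (k, l) * x l))"
proof -
  let ?L = "laplacian n E (\<lambda>_. 1) :: real mat" and ?M = "laplacian n E a"
  have entry: "laplacian n E (dual_weight a) $$ (k, l) = Dual (?L $$ (k, l)) (?M $$ (k, l))"
    if "k < n" "l < n" for k l
    using that laplacian_carrier[of n E "\<lambda>_. 1 :: real"] laplacian_carrier[of n E a]
    by (simp add: laplacian_dual_weight of_real_dual eps_def plus_dual_def times_dual_def)
  \<comment> \<open>The infinitesimal part of \<open>L\<^sub>w (x - y \<epsilon>)\<close> is
    \<open>M x - L y\<close>, which the choice of \<open>y\<close> makes zero.\<close>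
  have "resistance n E (dual_weight a) i j = Dual (x i) (- y i) - Dual (x j) (- y j)"
  proof (rule resistance_dual_eqI[OF ij])
    fix k assume k: "k < n"
    then show "(\<Sum>l<n. laplacian n E (dual_weight a) $$ (k, l) * Dual (x l) (- y l)) =
      (if k = i then 1 else 0) - (if k = j then 1 else 0)"
      using x[OF k] y[OF k] ij(1)
      by (auto simp: dual_eq_iff std_part_sum inf_part_sum entry times_dual_def sum.distrib
        sum_subtractf sum_negf one_dual_def zero_dual_def minus_dual_def)
  qed
  then have "inf_part (resistance n E (dual_weight a) i j) = - (y i - y j)"
    by (simp add: minus_dual_def)
  also have "y i - y j = (\<Sum>k<n. y k * (\<Sum>l<n. ?L $$ (k, l) * x l))"
  proof -
    have "(\<Sum>k<n. y k * (\<Sum>l<n. ?L $$ (k, l) * x l)) =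
        (\<Sum>k<n. (if k = i then y i else 0) - (if k = j then y j else 0))"
      by (intro sum.cong) (auto simp: x)
    then show ?thesis using ij by (simp add: sum_subtractf)
  qed
  also have "\<dots> = (\<Sum>k<n. x k * (\<Sum>l<n. ?M $$ (k, l) * x l))"
    unfolding laplacian_self_adjoint[of y] using y by simp
  finally show ?thesis .
qed

section \<open>The Kirchhoff index in an eigenbasis\<close>

text \<open>The spectral radius lives on the complexified matrix, whose characteristic polynomial is
  the image of the real one, so each listed value is also a complex eigenvalue.\<close>

lemma abs_eigenvalue_le_spectral_radius:
  assumes A: "A \<in> carrier_mat n n" and ev: "eigenvalue_listing A n f" and k: "k < n"
  shows "\<bar>f (Suc k)\<bar> \<le> real_spectral_radius A"
proof -
  let ?A = "map_mat complex_of_real A"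
  have "poly (char_poly A) (f (Suc k)) = 0"
    using ev k unfolding eigenvalue_listing_def
    by (auto simp: poly_prod prod.atLeast1_atMost_eq)
  moreover have "char_poly ?A = map_poly complex_of_real (char_poly A)"
    by (rule of_real_hom.char_poly_hom[OF A])
  ultimately have "poly (char_poly ?A) (complex_of_real (f (Suc k))) = 0" by simp
  then have "complex_of_real (f (Suc k)) \<in> spectrum ?A"
    unfolding spectrum_def using A eigenvalue_root_char_poly[of ?A n] by simp
  then have "cmod (complex_of_real (f (Suc k))) \<in> cmod ` spectrum ?A" by (rule imageI)
  from spectral_radius_mem_max(2)[OF _ _ this, of n] show ?thesis
    using A k by (simp add: real_spectral_radius_def)
qed

lemma sum_swap3:
  "(\<Sum>i\<in>A. \<Sum>j\<in>B. \<Sum>k\<in>C. f i j k) = (\<Sum>j\<in>B. \<Sum>k\<in>C. \<Sum>i\<in>A. f i j k)"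
proof -
  have "(\<Sum>i\<in>A. \<Sum>j\<in>B. \<Sum>k\<in>C. f i j k) = (\<Sum>j\<in>B. \<Sum>i\<in>A. \<Sum>k\<in>C. f i j k)"
    by (rule sum.swap)
  also have "\<dots> = (\<Sum>j\<in>B. \<Sum>k\<in>C. \<Sum>i\<in>A. f i j k)"
    by (rule sum.cong[OF refl sum.swap])
  finally show ?thesis .
qed

text \<open>Indices are shifted: \<open>lam k\<close> is the paper's \<open>\<lambda>\<^sub>k\<^sub>+\<^sub>1\<close>, so that \<open>q m\<close> is the constant eigenvector.\<close>

locale laplacian_eigenbasis =
  fixes n m :: nat and E :: "nat set set" and lam :: "nat \<Rightarrow> real" and q :: "nat \<Rightarrow> nat \<Rightarrow> real"
  assumes conn: "connected_graph n E"
    and n: "n = Suc m"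
    and ortho: "\<And>k l. k < n \<Longrightarrow> l < n \<Longrightarrow> (\<Sum>i<n. q k i * q l i) = (if k = l then 1 else 0)"
    and complete: "\<And>i j. i < n \<Longrightarrow> j < n \<Longrightarrow> (\<Sum>k<n. q k i * q k j) = (if i = j then 1 else 0)"
    and eigen: "\<And>k i. k < n \<Longrightarrow> i < n \<Longrightarrow>
      (\<Sum>j<n. laplacian n E (\<lambda>_. 1) $$ (i, j) * q k j) = lam k * q k i"
    and decr: "\<And>i j. i \<le> j \<Longrightarrow> j < n \<Longrightarrow> lam j \<le> lam i"
begin

abbreviation L :: "real mat" where "L \<equiv> laplacian n E (\<lambda>_. 1)"

section \<open>The spectrum of a connected Laplacian\<close>

lemma lam_quadratic_form:
  assumes k: "k < n"
  shows "(\<Sum>i<n. q k i * (\<Sum>j<n. L $$ (i, j) * q k j)) = lam k"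
proof -
  have "(\<Sum>i<n. q k i * (\<Sum>j<n. L $$ (i, j) * q k j)) = (\<Sum>i<n. lam k * (q k i * q k i))"
    using eigen[OF k] by (intro sum.cong) auto
  also have "\<dots> = lam k" using ortho[OF k k] unfolding sum_distrib_left[symmetric] by simp
  finally show ?thesis .
qed

lemma lam_nonneg:
  assumes k: "k < n"
  shows "lam k \<ge> 0"
proof -
  have "0 \<le> (\<Sum>i<n. \<Sum>j<n. (if {i, j} \<in> E then 1 else 0) * (q k i - q k j)\<^sup>2)"
    by (intro sum_nonneg) auto
  then show ?thesis
    using laplacian_quadratic_form[of "q k" n E "\<lambda>_. 1"] lam_quadratic_form[OF k] by simp
qed

lemma kernel_eigenvector_constant:
  assumes "k < n" "lam k = 0" "i < n" "j < n"
  shows "q k i = q k j"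
  by (rule laplacian_kernel_constant[OF conn]) (use eigen assms in auto)

text \<open>Both eigenvectors would be constant; two nonzero constant vectors cannot be
  orthogonal.\<close>

lemma zero_eigenvalue_unique:
  assumes kl: "k < n" "l < n" "lam k = 0" "lam l = 0"
  shows "k = l"
proof (rule ccontr)
  assume "k \<noteq> l"
  define ck cl where "ck = q k 0" and "cl = q l 0"
  have ck: "q k i = ck" and cl: "q l i = cl" if "i < n" for i
    unfolding ck_def cl_def by (rule kernel_eigenvector_constant; use kl that in simp)+
  have "(\<Sum>i<n. ck * cl) = 0" "(\<Sum>i<n. ck * ck) = 1" "(\<Sum>i<n. cl * cl) = 1"
    using ortho[of k l] ortho[of k k] ortho[of l l] kl \<open>k \<noteq> l\<close> by (simp_all add: ck cl)
  then show False by auto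
qed

text \<open>The all-ones vector lies in the kernel, and self-adjointness makes it orthogonal to
  every eigenvector of a nonzero eigenvalue.\<close>

lemma eigenvector_sum_zero:
  assumes k: "k < n" "lam k \<noteq> 0"
  shows "(\<Sum>i<n. q k i) = 0"
proof -
  have "lam k * (\<Sum>i<n. q k i) = (\<Sum>i<n. 1 * (\<Sum>j<n. L $$ (i, j) * q k j))"
    unfolding sum_distrib_left[of "lam k"] by (intro sum.cong) (use eigen k in auto)
  also have "\<dots> = (\<Sum>i<n. q k i * (\<Sum>j<n. L $$ (i, j) * 1))"
    by (rule laplacian_self_adjoint)
  also have "\<dots> = 0" using laplacian_mult_constant[of _ n E "\<lambda>_. 1 :: real"] by simp
  finally show ?thesis using k by simp
qed

text \<open>If no eigenvalue vanished, the all-ones vector would be orthogonal to the whole basis.\<close>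

lemma zero_eigenvalue_exists: "\<exists>k<n. lam k = 0"
proof (rule ccontr)
  assume "\<not> ?thesis"
  then have "(\<Sum>j<n. q k j) = 0" if "k < n" for k using eigenvector_sum_zero that by auto
  then have "(\<Sum>k<n. q k 0 * (\<Sum>j<n. q k j)) = 0" by simp
  also have "(\<Sum>k<n. q k 0 * (\<Sum>j<n. q k j)) = (\<Sum>j<n. \<Sum>k<n. q k 0 * q k j)"
    unfolding sum_distrib_left by (rule sum.swap)
  also have "\<dots> = (\<Sum>j<n. if j = 0 then 1 else 0)"
    by (intro sum.cong refl) (use complete[of 0] n in auto)
  also have "\<dots> = 1" unfolding n by (simp del: sum.lessThan_Suc)
  finally show False by simp
qed

lemma lam_last: "lam m = 0"
proof -
  obtain k where "k < n" "lam k = 0" using zero_eigenvalue_exists by blast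
  then show ?thesis using decr[of k m] lam_nonneg[of m] n by simp
qed

lemma lam_pos: "k < m \<Longrightarrow> lam k > 0"
  using zero_eigenvalue_unique[of k m] lam_nonneg[of k] lam_last n by force

lemma eigenvector_sum: "k < m \<Longrightarrow> (\<Sum>i<n. q k i) = 0"
  using eigenvector_sum_zero[of k] lam_pos[of k] n by simp

text \<open>The Moore-Penrose pseudoinverse of \<open>L\<close>, written in the eigenbasis; the sum
  stops before the index \<open>m\<close> of the kernel.\<close>

definition pinv :: "(nat \<Rightarrow> real) \<Rightarrow> nat \<Rightarrow> real" where
  "pinv b i = (\<Sum>k<m. (\<Sum>j<n. q k j * b j) / lam k * q k i)"

text \<open>Applying \<open>L\<close> cancels each \<open>lam k\<close>. The omitted component of
  \<open>b\<close> along \<open>q m\<close> is zero because \<open>q m\<close> is constant and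
  \<open>b\<close> sums to zero, so completeness rebuilds \<open>b\<close>.\<close>

lemma laplacian_pinv:
  assumes b: "(\<Sum>j<n. b j) = 0" and i: "i < n"
  shows "(\<Sum>j<n. L $$ (i, j) * pinv b j) = b i"
proof -
  define c where "c k = (\<Sum>j<n. q k j * b j)" for k
  have "(\<Sum>j<n. L $$ (i, j) * pinv b j) = (\<Sum>j<n. \<Sum>k<m. c k / lam k * (L $$ (i, j) * q k j))"
    unfolding pinv_def c_def[symmetric] sum_distrib_left by (simp only: mult.left_commute)
  also have "\<dots> = (\<Sum>k<m. c k / lam k * (\<Sum>j<n. L $$ (i, j) * q k j))"
    unfolding sum_distrib_left by (rule sum.swap)
  also have "\<dots> = (\<Sum>k<m. c k * q k i)"
  proof (intro sum.cong refl)
    fix k assume "k \<in> {..<m}"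
    then show "c k / lam k * (\<Sum>j<n. L $$ (i, j) * q k j) = c k * q k i"
      using eigen[of k i] i lam_pos[of k] n by simp
  qed
  also have "\<dots> = (\<Sum>k<n. c k * q k i)"
  proof -
    have "c m = (\<Sum>j<n. q m 0 * b j)"
      unfolding c_def using kernel_eigenvector_constant[of m _ 0] lam_last n
      by (intro sum.cong refl) (metis lessI lessThan_iff zero_less_Suc)
    then have "c m = 0" using b by (simp flip: sum_distrib_left)
    then show ?thesis unfolding n by simp
  qed
  also have "\<dots> = (\<Sum>k<n. \<Sum>j<n. b j * (q k i * q k j))"
    unfolding c_def sum_distrib_right by (simp only: mult_ac)
  also have "\<dots> = (\<Sum>j<n. b j * (\<Sum>k<n. q k i * q k j))"
    unfolding sum_distrib_left by (rule sum.swap)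
  also have "\<dots> = (\<Sum>j<n. if j = i then b j else 0)"
    by (intro sum.cong refl) (use complete[OF i] in auto)
  also have "\<dots> = b i" using i by simp
  finally show ?thesis .
qed

section \<open>Infinitesimal change of the Kirchhoff index\<close>

definition eig_form :: "(nat set \<Rightarrow> real) \<Rightarrow> nat \<Rightarrow> nat \<Rightarrow> real" where
  "eig_form a k l = (\<Sum>i<n. q k i * (\<Sum>j<n. laplacian n E a $$ (i, j) * q l j))"

text \<open>The real potential \<open>x\<close> has coefficients
  \<open>(q k i - q k j) / lam k\<close>. Since \<open>M x\<close> sums to zero
  (\<open>col_sum\<close>), \<open>pinv\<close> also supplies the correction \<open>y\<close> with
  \<open>L y = M x\<close>.\<close>

lemma inf_part_resistance_eigenbasis:
  assumes ij: "i < n" "j < n"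
  shows "inf_part (resistance n E (dual_weight a) i j) =
    - (\<Sum>k<m. \<Sum>l<m. (q k i - q k j) * (q l i - q l j) * (eig_form a k l / (lam k * lam l)))"
proof (cases "i = j")
  case True
  then show ?thesis by (simp add: resistance_def zero_dual_def)
next
  case False
  let ?M = "laplacian n E a"
  have col_sum: "(\<Sum>r<n. \<Sum>s<n. ?M $$ (r, s) * x s) = 0" for x
    using laplacian_self_adjoint[of "\<lambda>_. 1" n E a x] laplacian_mult_constant[of _ n E a] by simp
  define c where "c k = (q k i - q k j) / lam k" for k
  define x where "x = pinv (\<lambda>p. (if p = i then 1 else 0) - (if p = j then 1 else 0))"
  have "(\<Sum>p<n. q k p * ((if p = i then 1 else 0) - (if p = j then 1 else 0))) =
      (\<Sum>p<n. (if p = i then q k i else 0) - (if p = j then q k j else 0))" for k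
    by (intro sum.cong) auto
  then have "(\<Sum>p<n. q k p * ((if p = i then 1 else 0) - (if p = j then 1 else 0))) = q k i - q k j" for k
    using ij by (simp add: sum_subtractf)
  then have x_eq: "x p = (\<Sum>k<m. c k * q k p)" for p
    by (simp add: x_def pinv_def c_def)
  have Mx: "(\<Sum>s<n. ?M $$ (r, s) * x s) = (\<Sum>l<m. c l * (\<Sum>s<n. ?M $$ (r, s) * q l s))" for r
    unfolding x_eq sum_distrib_left by (subst sum.swap) (simp only: mult.left_commute)
  have "inf_part (resistance n E (dual_weight a) i j) =
      - (\<Sum>r<n. x r * (\<Sum>s<n. ?M $$ (r, s) * x s))"
  proof (rule inf_part_resistance[OF False ij])
    show "(\<Sum>s<n. L $$ (r, s) * x s) = (if r = i then 1 else 0) - (if r = j then 1 else 0)"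
      if "r < n" for r
      unfolding x_def by (rule laplacian_pinv[OF _ that]) (use ij in \<open>simp add: sum_subtractf\<close>)
    show "(\<Sum>s<n. L $$ (r, s) * pinv (\<lambda>r. \<Sum>s<n. ?M $$ (r, s) * x s) s) =
        (\<Sum>s<n. ?M $$ (r, s) * x s)" if "r < n" for r
      by (rule laplacian_pinv[OF col_sum that])
  qed
  also have "(\<Sum>r<n. x r * (\<Sum>s<n. ?M $$ (r, s) * x s)) =
      (\<Sum>r<n. \<Sum>k<m. \<Sum>l<m. c k * c l * (q k r * (\<Sum>s<n. ?M $$ (r, s) * q l s)))"
    unfolding Mx unfolding x_eq sum_product by (simp only: mult_ac)
  also have "\<dots> = (\<Sum>k<m. \<Sum>l<m. \<Sum>r<n. c k * c l * (q k r * (\<Sum>s<n. ?M $$ (r, s) * q l s)))"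
    by (rule sum_swap3)
  also have "\<dots> = (\<Sum>k<m. \<Sum>l<m. c k * c l * eig_form a k l)"
    unfolding eig_form_def by (simp only: sum_distrib_left[of "c _ * c _"])
  also have "\<dots> = (\<Sum>k<m. \<Sum>l<m. (q k i - q k j) * (q l i - q l j) * (eig_form a k l / (lam k * lam l)))"
    by (simp add: c_def mult_ac)
  finally show ?thesis .
qed

text \<open>After expansion the mixed terms contain entry sums of \<open>q k\<close> and
  \<open>q l\<close>, which vanish below \<open>m\<close>; each of the other two terms is
  \<open>n\<close> times their inner product.\<close>

lemma sum_eigenvector_differences:
  assumes kl: "k < m" "l < m"
  shows "(\<Sum>i<n. \<Sum>j<n. (q k i - q k j) * (q l i - q l j)) = (if k = l then 2 * real n else 0)"
proof -
  have "(\<Sum>i<n. \<Sum>j<n. (q k i - q k j) * (q l i - q l j)) =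
    (\<Sum>i<n. \<Sum>j<n. q k i * q l i) + (\<Sum>i<n. \<Sum>j<n. q k j * q l j)
    - (\<Sum>i<n. q k i * (\<Sum>j<n. q l j)) - (\<Sum>i<n. q l i * (\<Sum>j<n. q k j))"
    unfolding sum_distrib_left sum.distrib[symmetric] sum_subtractf[symmetric]
    by (intro sum.cong refl) (simp add: algebra_simps)
  also have "\<dots> = 2 * real n * (\<Sum>i<n. q k i * q l i)"
    using eigenvector_sum kl by (simp flip: sum_distrib_left)
  finally show ?thesis using ortho[of k l] kl n by simp
qed

lemma kirchhoff_perturbation_eq:
  "kirchhoff_perturbation n E a = - real n * (\<Sum>k<m. eig_form a k k / (lam k)\<^sup>2)"
proof -
  define b where "b k l = eig_form a k l / (lam k * lam l)" for k l
  define R where "R i j = (\<Sum>k<m. \<Sum>l<m. (q k i - q k j) * (q l i - q l j) * b k l)" for i j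
  \<comment> \<open>The unperturbed index enters through \<open>of_real\<close> and has
    infinitesimal part zero.\<close>
  have "kirchhoff_perturbation n E a =
      (\<Sum>j<n. \<Sum>i<j. inf_part (resistance n E (dual_weight a) i j))"
    unfolding kirchhoff_perturbation_def kirchhoff_index_def
    by (simp only: minus_dual_def of_real_dual inf_part_sum dual.sel diff_zero)
  also have "\<dots> = (\<Sum>j<n. \<Sum>i<j. - R i j)"
    unfolding R_def b_def by (intro sum.cong refl inf_part_resistance_eigenbasis) auto
  also have "\<dots> = - (\<Sum>j<n. \<Sum>i<j. R i j)" by (simp only: sum_negf)
  also have "2 * (\<Sum>j<n. \<Sum>i<j. R i j) = (\<Sum>i<n. \<Sum>j<n. R i j)"
    by (rule sum_lower_triangle) (auto intro!: sum.cong simp: R_def algebra_simps)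
  then have "(\<Sum>j<n. \<Sum>i<j. R i j) = (\<Sum>i<n. \<Sum>j<n. R i j) / 2" by simp
  also have "(\<Sum>i<n. \<Sum>j<n. R i j) =
      (\<Sum>i<n. \<Sum>k<m. \<Sum>l<m. \<Sum>j<n. (q k i - q k j) * (q l i - q l j) * b k l)"
    unfolding R_def
    by (intro sum.cong[OF refl] sum_swap3)
  also have "\<dots> = (\<Sum>k<m. \<Sum>l<m. \<Sum>i<n. \<Sum>j<n. (q k i - q k j) * (q l i - q l j) * b k l)"
    by (rule sum_swap3)
  also have "\<dots> = (\<Sum>k<m. \<Sum>l<m. if l = k then 2 * real n * (eig_form a k k / (lam k)\<^sup>2) else 0)"
    unfolding sum_distrib_right[symmetric]
    by (intro sum.cong refl) (auto simp: sum_eigenvector_differences b_def power2_eq_square)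
  also have "\<dots> = 2 * real n * (\<Sum>k<m. eig_form a k k / (lam k)\<^sup>2)"
    by (simp add: sum_distrib_left)
  finally show ?thesis by simp
qed

lemma abs_kirchhoff_perturbation_le:
  fixes u :: "nat \<Rightarrow> nat \<Rightarrow> real" and mu :: "nat \<Rightarrow> real"
  assumes u_complete: "\<And>i j. i < n \<Longrightarrow> j < n \<Longrightarrow> (\<Sum>p<n. u p i * u p j) = (if i = j then 1 else 0)"
    and u_eigen: "\<And>p i. p < n \<Longrightarrow> i < n \<Longrightarrow>
      (\<Sum>j<n. laplacian n E a $$ (i, j) * u p j) = mu p * u p i"
  defines "c \<equiv> \<lambda>p k. (\<Sum>i<n. u p i * q k i)\<^sup>2"
  shows "\<bar>kirchhoff_perturbation n E a\<bar> \<le> real n * (\<Sum>k<m. (\<Sum>p<n. \<bar>mu p\<bar> * c p k) / (lam k)\<^sup>2)"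
proof -
  let ?M = "laplacian n E a"
  have form: "eig_form a k k = (\<Sum>p<n. mu p * c p k)" for k
  proof -
    \<comment> \<open>This is the spectral decomposition of \<open>M\<close> into rank-one terms; it
      follows from inserting the completeness relation of \<open>u\<close>.\<close>
    have entry: "?M $$ (i, j) = (\<Sum>p<n. mu p * (u p i * u p j))" if ij: "i < n" "j < n" for i j
    proof -
      have "(\<Sum>p<n. mu p * (u p i * u p j)) = (\<Sum>p<n. \<Sum>s<n. ?M $$ (i, s) * (u p s * u p j))"
      proof (intro sum.cong refl)
        fix p assume "p \<in> {..<n}"
        then show "mu p * (u p i * u p j) = (\<Sum>s<n. ?M $$ (i, s) * (u p s * u p j))"
          using u_eigen[of p i, symmetric] ij
          by (simp add: sum_distrib_right mult.assoc[symmetric])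
      qed
      also have "\<dots> = (\<Sum>s<n. ?M $$ (i, s) * (\<Sum>p<n. u p s * u p j))"
        unfolding sum_distrib_left by (rule sum.swap)
      also have "\<dots> = (\<Sum>s<n. if s = j then ?M $$ (i, s) else 0)"
        by (intro sum.cong refl) (use u_complete ij in auto)
      finally show ?thesis using ij by simp
    qed
    have "eig_form a k k = (\<Sum>i<n. \<Sum>j<n. \<Sum>p<n. mu p * (u p i * q k i * (u p j * q k j)))"
      unfolding eig_form_def sum_distrib_left
      by (intro sum.cong refl) (simp add: entry sum_distrib_left sum_distrib_right mult_ac)
    also have "\<dots> = (\<Sum>p<n. \<Sum>i<n. \<Sum>j<n. mu p * (u p i * q k i * (u p j * q k j)))"
      by (rule sum_swap3[symmetric])
    also have "\<dots> = (\<Sum>p<n. mu p * c p k)"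
      unfolding c_def power2_eq_square sum_product by (simp only: sum_distrib_left)
    finally show ?thesis .
  qed
  have "\<bar>kirchhoff_perturbation n E a\<bar> = real n * \<bar>\<Sum>k<m. eig_form a k k / (lam k)\<^sup>2\<bar>"
    by (simp add: kirchhoff_perturbation_eq abs_mult)
  also have "\<dots> \<le> real n * (\<Sum>k<m. \<bar>eig_form a k k / (lam k)\<^sup>2\<bar>)"
    by (intro mult_left_mono sum_abs) simp
  also have "\<dots> \<le> real n * (\<Sum>k<m. (\<Sum>p<n. \<bar>mu p\<bar> * c p k) / (lam k)\<^sup>2)"
  proof (intro mult_left_mono sum_mono)
    fix k
    have "\<bar>eig_form a k k\<bar> \<le> (\<Sum>p<n. \<bar>mu p * c p k\<bar>)" unfolding form by (rule sum_abs)
    also have "\<dots> = (\<Sum>p<n. \<bar>mu p\<bar> * c p k)" by (simp add: abs_mult c_def)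
    finally show "\<bar>eig_form a k k / (lam k)\<^sup>2\<bar> \<le> (\<Sum>p<n. \<bar>mu p\<bar> * c p k) / (lam k)\<^sup>2"
      by (simp add: abs_divide divide_right_mono)
  qed simp
  finally show ?thesis .
qed

end

text \<open>Expanding the squares leaves a double sum that completeness collapses to its diagonal.
  Applied to both eigenbases, it makes the squared overlaps doubly stochastic.\<close>

lemma parseval:
  fixes q :: "nat \<Rightarrow> nat \<Rightarrow> real"
  assumes "\<And>i j. i < n \<Longrightarrow> j < n \<Longrightarrow> (\<Sum>k<n. q k i * q k j) = (if i = j then 1 else 0)"
  shows "(\<Sum>k<n. (\<Sum>i<n. q k i * x i)\<^sup>2) = (\<Sum>i<n. x i * x i)"
proof -
  have "(\<Sum>k<n. (\<Sum>i<n. q k i * x i)\<^sup>2) = (\<Sum>k<n. \<Sum>i<n. \<Sum>j<n. x i * x j * (q k i * q k j))"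
    unfolding power2_eq_square sum_product by (simp only: mult_ac)
  also have "\<dots> = (\<Sum>i<n. \<Sum>j<n. x i * x j * (\<Sum>k<n. q k i * q k j))"
    unfolding sum_distrib_left by (rule sum_swap3)
  also have "\<dots> = (\<Sum>i<n. \<Sum>j<n. if j = i then x i * x i else 0)"
    by (intro sum.cong refl) (use assms in auto)
  finally show ?thesis by simp
qed

section \<open>The two bounds\<close>

theorem theorem3p7:
  fixes n :: nat and E :: "nat set set" and a :: "nat set \<Rightarrow> real"
    and lam mu :: "nat \<Rightarrow> real"
  assumes "connected_graph n E"
    and "eigenvalue_listing (laplacian n E (\<lambda>_. 1)) n lam"
    and "\<And>i j. 1 \<le> i \<Longrightarrow> i \<le> j \<Longrightarrow> j \<le> n \<Longrightarrow> lam j \<le> lam i"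
    and "eigenvalue_listing (laplacian n E a) n mu"
  shows "\<bar>kirchhoff_perturbation n E a\<bar> \<le> real n / (lam (n - 1))\<^sup>2 * (\<Sum>i=1..n. \<bar>mu i\<bar>) \<and>
    \<bar>kirchhoff_perturbation n E a\<bar> \<le>
      real n * real_spectral_radius (laplacian n E a) * (\<Sum>i=1..n-1. 1 / (lam i)\<^sup>2)"
proof -
  obtain m where n: "n = Suc m" using assms(1) unfolding connected_graph_def by (cases n) auto
  obtain q :: "nat \<Rightarrow> nat \<Rightarrow> real" where
    q: "\<And>k l. k < n \<Longrightarrow> l < n \<Longrightarrow> (\<Sum>i<n. q k i * q l i) = (if k = l then 1 else 0)"
      "\<And>i j. i < n \<Longrightarrow> j < n \<Longrightarrow> (\<Sum>k<n. q k i * q k j) = (if i = j then 1 else 0)"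
      "\<And>k i. k < n \<Longrightarrow> i < n \<Longrightarrow>
        (\<Sum>j<n. laplacian n E (\<lambda>_. 1) $$ (i, j) * q k j) = lam (Suc k) * q k i"
    using symmetric_eigenbasis[OF laplacian_carrier transpose_laplacian assms(2)] by blast
  obtain u :: "nat \<Rightarrow> nat \<Rightarrow> real" where
    u: "\<And>k l. k < n \<Longrightarrow> l < n \<Longrightarrow> (\<Sum>i<n. u k i * u l i) = (if k = l then 1 else 0)"
      "\<And>i j. i < n \<Longrightarrow> j < n \<Longrightarrow> (\<Sum>k<n. u k i * u k j) = (if i = j then 1 else 0)"
      "\<And>k i. k < n \<Longrightarrow> i < n \<Longrightarrow>
        (\<Sum>j<n. laplacian n E a $$ (i, j) * u k j) = mu (Suc k) * u k i"
    using symmetric_eigenbasis[OF laplacian_carrier transpose_laplacian assms(4)] by blast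
  interpret laplacian_eigenbasis n m E "\<lambda>k. lam (Suc k)" q
    by unfold_locales (use assms(1,3) n q in auto)
  define c where "c p k = (\<Sum>i<n. u p i * q k i)\<^sup>2" for p k
  have c_nonneg: "c p k \<ge> 0" for p k by (simp add: c_def)
  have c_sum_p: "(\<Sum>p<n. c p k) = 1" if "k < n" for k
    using parseval[of n u "q k"] u(2) q(1)[OF that that] by (simp add: c_def)
  have "(\<Sum>k<n. c p k) = 1" if "p < n" for p
    using parseval[of n q "u p"] q(2) u(1)[OF that that] by (simp add: c_def mult.commute)
  \<comment> \<open>Dropping the nonnegative term \<open>k = m\<close> leaves only an
    inequality.\<close>
  then have c_sum_k: "(\<Sum>k<m. c p k) \<le> 1" if "p < n" for p
    using that c_nonneg[of p m] n by fastforce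
  have bound: "\<bar>kirchhoff_perturbation n E a\<bar> \<le>
      real n * (\<Sum>k<m. (\<Sum>p<n. \<bar>mu (Suc p)\<bar> * c p k) / (lam (Suc k))\<^sup>2)"
    unfolding c_def by (rule abs_kirchhoff_perturbation_le) (use u in auto)

  \<comment> \<open>Bound (a): in the unshifted listing \<open>lam m\<close> is \<lambda>_{n-1}, the
    smallest nonzero eigenvalue when \<open>m > 0\<close>. For \<open>m = 0\<close> the sums over
    \<open>k\<close> are empty. Summing over \<open>k\<close> first then removes the
    overlaps.\<close>
  have "(\<Sum>k<m. (\<Sum>p<n. \<bar>mu (Suc p)\<bar> * c p k) / (lam (Suc k))\<^sup>2) \<le>
      (\<Sum>k<m. (\<Sum>p<n. \<bar>mu (Suc p)\<bar> * c p k) / (lam m)\<^sup>2)"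
  proof (intro sum_mono divide_left_mono power_mono mult_pos_pos zero_less_power)
    fix k assume "k \<in> {..<m}"
    then show "lam m \<le> lam (Suc k)" "lam m \<ge> 0" "lam m > 0" "lam (Suc k) > 0"
      using assms(3)[of "Suc k" m] n lam_pos[of "m - 1"] lam_pos[of k] by auto
  qed (intro sum_nonneg mult_nonneg_nonneg c_nonneg, simp)
  also have "\<dots> = (\<Sum>k<m. \<Sum>p<n. \<bar>mu (Suc p)\<bar> * c p k) / (lam m)\<^sup>2"
    by (simp only: sum_divide_distrib)
  also have "(\<Sum>k<m. \<Sum>p<n. \<bar>mu (Suc p)\<bar> * c p k) = (\<Sum>p<n. \<bar>mu (Suc p)\<bar> * (\<Sum>k<m. c p k))"
    unfolding sum_distrib_left by (rule sum.swap)
  also have "(\<Sum>p<n. \<bar>mu (Suc p)\<bar> * (\<Sum>k<m. c p k)) / (lam m)\<^sup>2 \<le> (\<Sum>p<n. \<bar>mu (Suc p)\<bar>) / (lam m)\<^sup>2"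
  proof (intro divide_right_mono sum_mono)
    fix p assume "p \<in> {..<n}"
    then show "\<bar>mu (Suc p)\<bar> * (\<Sum>k<m. c p k) \<le> \<bar>mu (Suc p)\<bar>"
      using c_sum_k[of p] by (simp add: mult_left_le)
  qed simp
  finally have "real n * (\<Sum>k<m. (\<Sum>p<n. \<bar>mu (Suc p)\<bar> * c p k) / (lam (Suc k))\<^sup>2) \<le>
      real n * ((\<Sum>p<n. \<bar>mu (Suc p)\<bar>) / (lam m)\<^sup>2)"
    by (rule mult_left_mono) simp
  with bound have *: "\<bar>kirchhoff_perturbation n E a\<bar> \<le> real n * ((\<Sum>p<n. \<bar>mu (Suc p)\<bar>) / (lam m)\<^sup>2)"
    by linarith

  \<comment> \<open>Bound (b): here the \<open>mu\<close> are bounded first, and the overlaps are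
    summed over \<open>p\<close>, where they give exactly one.\<close>
  define rho where "rho = real_spectral_radius (laplacian n E a)"
  have "(\<Sum>k<m. (\<Sum>p<n. \<bar>mu (Suc p)\<bar> * c p k) / (lam (Suc k))\<^sup>2) \<le>
      (\<Sum>k<m. rho * (1 / (lam (Suc k))\<^sup>2))"
  proof (rule sum_mono)
    fix k assume "k \<in> {..<m}"
    then have k: "k < n" using n by simp
    have "(\<Sum>p<n. \<bar>mu (Suc p)\<bar> * c p k) \<le> (\<Sum>p<n. rho * c p k)"
      unfolding rho_def
      by (intro sum_mono mult_right_mono c_nonneg
        abs_eigenvalue_le_spectral_radius[OF laplacian_carrier assms(4)]) simp
    also have "\<dots> = rho" using c_sum_p[OF k] by (simp flip: sum_distrib_left)
    finally show "(\<Sum>p<n. \<bar>mu (Suc p)\<bar> * c p k) / (lam (Suc k))\<^sup>2 \<le> rho * (1 / (lam (Suc k))\<^sup>2)"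
      by (simp add: divide_right_mono)
  qed
  also have "\<dots> = rho * (\<Sum>k<m. 1 / (lam (Suc k))\<^sup>2)" by (simp only: sum_distrib_left)
  finally have "real n * (\<Sum>k<m. (\<Sum>p<n. \<bar>mu (Suc p)\<bar> * c p k) / (lam (Suc k))\<^sup>2) \<le>
      real n * (rho * (\<Sum>k<m. 1 / (lam (Suc k))\<^sup>2))"
    by (rule mult_left_mono) simp
  with bound have **: "\<bar>kirchhoff_perturbation n E a\<bar> \<le> real n * (rho * (\<Sum>k<m. 1 / (lam (Suc k))\<^sup>2))"
    by linarith
  have m: "n - 1 = m" using n by simp
  show ?thesis
    using * ** unfolding m by (simp add: rho_def sum.atLeast1_atMost_eq mult.assoc)
qed

end
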